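(* For all integers $n\geq 3$, we have $$|S_n^{(3)}(312:123:231)|=|S_n^{(3)}(132:321:213)|=\tfrac12 (n+7)(n-2).$$
   Context: $S_n$ denotes the set of permutations $p=p(1)p(2)\cdots p(n)$ of $\{1,2,\ldots,n\}$ in one-line notation. For $p\in S_n$ and $q\in S_m$, $p$ contains $q$ as a pattern if there exist $1\leq i_1<\cdots<i_m\leq n$ such that for all $1\leq a<b\leq m$, $p(i_a)<p(i_b)$ if and only if $q(a)<q(b)$; otherwise $p$ avoids $q$. The rotations of $p\in S_n$ are $p^{(1)}=p$ and, for $i\in\{2,\ldots,n\}$, $p^{(i)}=p(i)p(i+1)\cdots p(n)p(1)p(2)\cdots p(i-1)$. For $q_1,q_2,q_3\in S_3$, $S_n^{(3)}(q_1:q_2:q_3)$ is the set of $p\in S_n$ such that $p^{(i)}$ avoids $q_i$ for all $i\in\{1,2,3\}$. *)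

theory Defs
  imports Complex_Main "HOL-Combinatorics.Multiset_Permutations"
begin

text \<open>
  A permutation in \<open>S\<^sub>n\<close> is represented by its one-line notation: a list in
  \<^term>\<open>permutations_of_set {1..n}\<close>. List positions count from 0, so \<open>p(i)\<close> is
  \<open>p ! (i - 1)\<close>.
\<close>

definition contains_pattern :: "nat list \<Rightarrow> nat list \<Rightarrow> bool" where
  "contains_pattern p q \<longleftrightarrow>
     (\<exists>i :: nat \<Rightarrow> nat. strict_mono_on {..<length q} i \<and> i ` {..<length q} \<subseteq> {..<length p} \<and>
        (\<forall>a b. a < b \<and> b < length q \<longrightarrow> (p ! i a < p ! i b \<longleftrightarrow> q ! a < q ! b)))"

abbreviation avoids_pattern :: "nat list \<Rightarrow> nat list \<Rightarrow> bool" where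
  "avoids_pattern p q \<equiv> \<not> contains_pattern p q"

text \<open>The rotation \<open>p\<^sup>(\<^sup>i\<^sup>)\<close>, for \<open>1 \<le> i \<le> n\<close>; it starts with the entry \<open>p(i)\<close>.\<close>

definition rotation :: "nat list \<Rightarrow> nat \<Rightarrow> nat list" where
  "rotation p i = rotate (i - 1) p"

definition S3 :: "nat \<Rightarrow> nat list \<Rightarrow> nat list \<Rightarrow> nat list \<Rightarrow> nat list set" where
  "S3 n q1 q2 q3 = {p \<in> permutations_of_set {1..n}.
     avoids_pattern (rotation p 1) q1 \<and>
     avoids_pattern (rotation p 2) q2 \<and>
     avoids_pattern (rotation p 3) q3}"

end

theory Submission
  imports Defs
begin

text \<open>
  Write \<open>p = a b r\<close>. The three avoidance conditions for \<open>312 : 123 : 231\<close> together say that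
  \<open>r\<close> contains no cyclically increasing triple, that every ascent \<open>x \<dots> y\<close> of \<open>r\<close> (not necessarily
  of adjacent entries) has both \<open>a\<close> and \<open>b\<close> strictly between \<open>x\<close> and \<open>y\<close>, and that no entry lies
  strictly between \<open>b\<close> and \<open>a\<close> when \<open>b < a\<close>. If \<open>r\<close> is decreasing, this leaves the choices
  \<open>a < b\<close> or \<open>a = b + 1\<close>, which are \<open>n(n - 1)/2 + (n - 1)\<close> in number. Otherwise all entries of \<open>r\<close>
  below \<open>a, b\<close> precede all those above, so \<open>r = k \<dots> 1 n \<dots> k+3\<close> with \<open>{a, b} = {k+1, k+2}\<close> and
  \<open>1 \<le> k \<le> n - 3\<close>, which gives \<open>2(n - 3)\<close> further permutations. Complementing the values
  turns \<open>312 : 123 : 231\<close> into \<open>132 : 321 : 213\<close>.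
\<close>

section \<open>Conditions on pairs and triples of list entries, and patterns of length three\<close>

fun triplewise :: "('a \<Rightarrow> 'a \<Rightarrow> 'a \<Rightarrow> bool) \<Rightarrow> 'a list \<Rightarrow> bool" where
  "triplewise P [] \<longleftrightarrow> True"
| "triplewise P (x # xs) \<longleftrightarrow> sorted_wrt (P x) xs \<and> triplewise P xs"

lemma triplewise_iff_nth:
  "triplewise P xs \<longleftrightarrow>
     (\<forall>i j k. i < j \<longrightarrow> j < k \<longrightarrow> k < length xs \<longrightarrow> P (xs ! i) (xs ! j) (xs ! k))"
proof (induction xs)
  case (Cons x xs)
  show ?case
  proof
    assume L: "triplewise P (x # xs)"
    show "\<forall>i j k. i < j \<longrightarrow> j < k \<longrightarrow> k < length (x # xs) \<longrightarrow>
        P ((x # xs) ! i) ((x # xs) ! j) ((x # xs) ! k)"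
    proof (intro allI impI)
      fix i j k assume ijk: "i < j" "j < k" "k < length (x # xs)"
      then obtain j' k' where "j = Suc j'" "k = Suc k'"
        by (metis less_nat_zero_code not0_implies_Suc)
      with ijk L Cons.IH show "P ((x # xs) ! i) ((x # xs) ! j) ((x # xs) ! k)"
        by (cases i) (auto simp: sorted_wrt_iff_nth_less)
    qed
  next
    assume R: "\<forall>i j k. i < j \<longrightarrow> j < k \<longrightarrow> k < length (x # xs) \<longrightarrow>
        P ((x # xs) ! i) ((x # xs) ! j) ((x # xs) ! k)"
    have "P x (xs ! j) (xs ! k)" if "j < k" "k < length xs" for j k
      using R[rule_format, of 0 "Suc j" "Suc k"] that by simp
    moreover have "P (xs ! i) (xs ! j) (xs ! k)" if "i < j" "j < k" "k < length xs" for i j k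
      using R[rule_format, of "Suc i" "Suc j" "Suc k"] that by simp
    ultimately show "triplewise P (x # xs)"
      using Cons.IH by (auto simp: sorted_wrt_iff_nth_less)
  qed
qed simp

text \<open>Rotation moves leading entries to the end, so triples have to be split off at that end
  as well as at the front.\<close>

lemma triplewise_snoc:
  "triplewise P (xs @ [a]) \<longleftrightarrow> triplewise P xs \<and> sorted_wrt (\<lambda>x y. P x y a) xs"
  by (induction xs) (auto simp: sorted_wrt_append)

lemma contains_pattern_triple:
  "contains_pattern p [x, y, z] \<longleftrightarrow>
     \<not> triplewise (\<lambda>u v w. \<not> ((u < v \<longleftrightarrow> x < y) \<and> (u < w \<longleftrightarrow> x < z) \<and> (v < w \<longleftrightarrow> y < z))) p"
  (is "?L \<longleftrightarrow> \<not> triplewise (\<lambda>u v w. \<not> ?Q u v w) p")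
proof -
  have "?L \<longleftrightarrow> (\<exists>i j k. i < j \<and> j < k \<and> k < length p \<and> ?Q (p ! i) (p ! j) (p ! k))" (is "_ \<longleftrightarrow> ?R")
  proof
    assume ?L
    then obtain i where i: "strict_mono_on {..<3} i" "i ` {..<3} \<subseteq> {..<length p}"
      "\<And>a b. a < b \<Longrightarrow> b < 3 \<Longrightarrow> (p ! i a < p ! i b \<longleftrightarrow> [x, y, z] ! a < [x, y, z] ! b)"
      unfolding contains_pattern_def by (auto simp: numeral_3_eq_3)
    have "i 0 < i 1" "i 1 < i 2"
      using i(1) by (auto simp: strict_mono_on_def)
    moreover have "i 2 < length p"
      using i(2) by (auto simp: image_subset_iff)
    moreover have "?Q (p ! i 0) (p ! i 1) (p ! i 2)"
      using i(3)[of 0 1] i(3)[of 0 2] i(3)[of 1 2] by simp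
    ultimately show ?R by blast
  next
    assume ?R
    then obtain i j k where ijk: "i < j" "j < k" "k < length p" "?Q (p ! i) (p ! j) (p ! k)"
      by blast
    \<comment> \<open>Only the values of this embedding at 0, 1 and 2 matter.\<close>
    let ?f = "\<lambda>m. [i, j, k] ! m"
    have lt: "m < 3 \<longleftrightarrow> m = 0 \<or> m = 1 \<or> m = 2" for m :: nat by auto
    have "strict_mono_on {..<3} ?f"
      using ijk by (auto simp: strict_mono_on_def lt)
    moreover have "?f ` {..<3} \<subseteq> {..<length p}"
      using ijk by (auto simp: lt)
    moreover have "p ! ?f a < p ! ?f b \<longleftrightarrow> [x, y, z] ! a < [x, y, z] ! b" if "a < b" "b < 3" for a b
    proof -
      have "a = 0 \<and> b = 1 \<or> a = 0 \<and> b = 2 \<or> a = 1 \<and> b = 2" using that by auto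
      with ijk(4) show ?thesis by auto
    qed
    ultimately show ?L
      unfolding contains_pattern_def by (intro exI[of _ ?f]) (simp add: numeral_3_eq_3)
  qed
  then show ?thesis
    unfolding triplewise_iff_nth by blast
qed

text \<open>Asymmetry suffices, without transitivity: if the heads differed, each would stand before
  the other in one of the lists, giving \<open>P x y\<close> and \<open>P y x\<close>.\<close>

lemma sorted_wrt_unique:
  assumes "sorted_wrt P xs" "sorted_wrt P ys" "set xs = set ys"
    and asym: "\<And>x y. P x y \<Longrightarrow> \<not> P y x"
  shows "xs = ys"
  using assms(1-3)
proof (induction xs arbitrary: ys)
  case (Cons x xs)
  then obtain y ys' where ys: "ys = y # ys'" by (cases ys) auto
  have "x = y"
  proof (rule ccontr)
    assume "x \<noteq> y"
    then have "y \<in> set xs" "x \<in> set ys'" using Cons.prems(3) ys by auto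
    then have "P x y" "P y x" using Cons.prems ys by auto
    then show False using asym by blast
  qed
  \<comment> \<open>Asymmetry at equal arguments is irreflexivity, so a head cannot recur in its
    tail.\<close>
  moreover have "x \<notin> set xs" "y \<notin> set ys'" using Cons.prems(1,2) ys asym by fastforce+
  then have "set xs = set ys'" using Cons.prems(3) ys \<open>x = y\<close> by auto
  ultimately show ?case using Cons ys by auto
qed simp

section \<open>Translation of the avoidance conditions into conditions on \<open>a\<close>,
  \<open>b\<close> and \<open>r\<close>\<close>

definition straddles :: "nat \<Rightarrow> nat \<Rightarrow> nat list \<Rightarrow> bool" where
  "straddles a b xs \<longleftrightarrow> sorted_wrt (\<lambda>x y. x < y \<longrightarrow> x < a \<and> a < y \<and> x < b \<and> b < y) xs"

text \<open>The disjuncts are the patterns 123, 312 and 231. The list \<open>r\<close> is a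
  contiguous block of all three rotations \<open>a b r\<close>, \<open>b r a\<close> and
  \<open>r a b\<close>, so it has to avoid all of them.\<close>

definition cyc_increasing :: "nat \<Rightarrow> nat \<Rightarrow> nat \<Rightarrow> bool" where
  "cyc_increasing x y z \<longleftrightarrow> x < y \<and> y < z \<or> y < z \<and> z < x \<or> z < x \<and> x < y"

lemma sorted_wrt_conj:
  "sorted_wrt (\<lambda>x y. P x y \<and> Q x y) xs \<longleftrightarrow> sorted_wrt P xs \<and> sorted_wrt Q xs"
  by (induction xs) auto

lemma triplewise_conj:
  "triplewise (\<lambda>x y z. P x y z \<and> Q x y z) xs \<longleftrightarrow> triplewise P xs \<and> triplewise Q xs"
  by (induction xs) (auto simp: sorted_wrt_conj)

lemma sorted_wrt_cong_distinct:
  assumes "distinct xs"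
    and "\<And>x y. x \<in> set xs \<Longrightarrow> y \<in> set xs \<Longrightarrow> x \<noteq> y \<Longrightarrow> P x y \<longleftrightarrow> Q x y"
  shows "sorted_wrt P xs \<longleftrightarrow> sorted_wrt Q xs"
  using assms by (induction xs) auto

lemma triplewise_cong_distinct:
  assumes "distinct xs"
    and "\<And>x y z. distinct [x, y, z] \<Longrightarrow> P x y z \<longleftrightarrow> Q x y z"
  shows "triplewise P xs \<longleftrightarrow> triplewise Q xs"
  using assms(1)
proof (induction xs)
  case (Cons x xs)
  have "sorted_wrt (P x) xs \<longleftrightarrow> sorted_wrt (Q x) xs"
    using Cons.prems by (intro sorted_wrt_cong_distinct assms(2)) auto
  with Cons show ?case by simp
qed simp

text \<open>Triples of entries are sorted by how many of \<open>a\<close> and \<open>b\<close> they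
  contain: none gives the cyclic condition, one gives \<open>straddles\<close>, both give the
  condition on entries between \<open>b\<close> and \<open>a\<close>.\<close>

lemma avoids_rotations_iff:
  assumes "distinct (a # b # r)"
  shows "avoids_pattern (rotation (a # b # r) 1) [3, 1, 2] \<and>
         avoids_pattern (rotation (a # b # r) 2) [1, 2, 3] \<and>
         avoids_pattern (rotation (a # b # r) 3) [2, 3, 1] \<longleftrightarrow>
         straddles a b r \<and> triplewise (\<lambda>x y z. \<not> cyc_increasing x y z) r \<and>
         (\<forall>x\<in>set r. \<not> (b < x \<and> x < a))"
    (is "?L \<longleftrightarrow> ?R")
proof -
  \<comment> \<open>\<open>F\<close>, \<open>G\<close> and \<open>H\<close> say that a triple is not
    of the form 312, 123 and 231 respectively, in the shape that
    \<open>contains_pattern_triple\<close> produces.\<close>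
  define F where "F x y z \<longleftrightarrow> \<not> (\<not> x < y \<and> \<not> x < z \<and> y < z)" for x y z :: nat
  define G where "G x y z \<longleftrightarrow> \<not> (x < y \<and> x < z \<and> y < z)" for x y z :: nat
  define H where "H x y z \<longleftrightarrow> \<not> (x < y \<and> \<not> x < z \<and> \<not> y < z)" for x y z :: nat
  have rot: "rotation (a # b # r) 1 = a # b # r" "rotation (a # b # r) 2 = (b # r) @ [a]"
    "rotation (a # b # r) 3 = (r @ [a]) @ [b]"
    by (simp_all add: rotation_def numeral_3_eq_3 numeral_2_eq_2)
  have c: "contains_pattern p [3,1,2] \<longleftrightarrow> \<not> triplewise F p"
    "contains_pattern p [1,2,3] \<longleftrightarrow> \<not> triplewise G p"
    "contains_pattern p [2,3,1] \<longleftrightarrow> \<not> triplewise H p" for p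
    unfolding contains_pattern_triple F_def G_def H_def by simp_all
  have ab: "a \<notin> set r" "b \<notin> set r" "a \<noteq> b" "distinct r" using assms by auto
  have "?L \<longleftrightarrow> triplewise (\<lambda>x y z. F x y z \<and> G x y z \<and> H x y z) r \<and>
      sorted_wrt (\<lambda>x y. F a x y \<and> F b x y \<and> G b x y \<and> G x y a \<and> H x y a \<and> H x y b) r \<and>
      (\<forall>x\<in>set r. F a b x \<and> G b x a \<and> H x a b)"
    unfolding rot c triplewise_snoc triplewise.simps sorted_wrt_append triplewise_conj sorted_wrt_conj
    by auto
  also have "triplewise (\<lambda>x y z. F x y z \<and> G x y z \<and> H x y z) r \<longleftrightarrow>
      triplewise (\<lambda>x y z. \<not> cyc_increasing x y z) r"
    by (rule triplewise_cong_distinct[OF ab(4)])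
       (auto simp: F_def G_def H_def cyc_increasing_def)
  \<comment> \<open>Only \<open>x < y\<close> matters. Then \<open>F a x y\<close> and
    \<open>G x y a\<close> give \<open>a < y\<close>, \<open>H x y a\<close> gives
    \<open>x < a\<close>, and \<open>F b x y\<close>, \<open>G b x y\<close>, \<open>H x y b\<close>
    do the same for \<open>b\<close>.\<close>
  also have "sorted_wrt (\<lambda>x y. F a x y \<and> F b x y \<and> G b x y \<and> G x y a \<and> H x y a \<and> H x y b) r \<longleftrightarrow>
      straddles a b r"
    unfolding straddles_def
  proof (rule sorted_wrt_cong_distinct[OF ab(4)])
    fix x y assume "x \<in> set r" "y \<in> set r" "x \<noteq> y"
    then have "x \<noteq> a" "x \<noteq> b" "y \<noteq> a" "y \<noteq> b" using ab by auto
    with \<open>x \<noteq> y\<close> show "(F a x y \<and> F b x y \<and> G b x y \<and> G x y a \<and> H x y a \<and> H x y b) =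
       (x < y \<longrightarrow> x < a \<and> a < y \<and> x < b \<and> b < y)"
      unfolding F_def G_def H_def by linarith
  qed
  \<comment> \<open>All three rotations forbid the same thing here, namely
    \<open>b < x < a\<close>.\<close>
  also have "(\<forall>x\<in>set r. F a b x \<and> G b x a \<and> H x a b) \<longleftrightarrow> (\<forall>x\<in>set r. \<not> (b < x \<and> x < a))"
  proof (rule ball_cong[OF refl])
    fix x assume "x \<in> set r"
    then have "x \<noteq> a" "x \<noteq> b" using ab by auto
    with ab(3) show "(F a b x \<and> G b x a \<and> H x a b) = (\<not> (b < x \<and> x < a))"
      unfolding F_def G_def H_def by linarith
  qed
  finally show ?thesis by blast
qed

section \<open>The shape of a tail that is not decreasing\<close>

definition two_runs :: "nat \<Rightarrow> nat \<Rightarrow> nat list" where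
  "two_runs n k = rev [1..<k + 1] @ rev [k + 3..<n + 1]"

text \<open>This relation is asymmetric, so by \<open>sorted_wrt_unique\<close> a tail sorted by it
  is \<open>two_runs n k\<close> as soon as the entries agree.\<close>

definition run_order :: "nat \<Rightarrow> nat \<Rightarrow> nat \<Rightarrow> bool" where
  "run_order k x y \<longleftrightarrow> (if x \<le> k then y < x \<or> k < y else k < y \<and> y < x)"

lemma sorted_wrt_two_runs: "sorted_wrt (run_order k) (two_runs n k)"
  unfolding two_runs_def sorted_wrt_append sorted_wrt_rev
proof (intro conjI ballI)
  show "sorted_wrt (\<lambda>x y. run_order k y x) [1..<k + 1]"
    by (rule sorted_wrt_mono_rel[OF _ sorted_wrt_upt]) (auto simp: run_order_def)
  show "sorted_wrt (\<lambda>x y. run_order k y x) [k + 3..<n + 1]"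
    by (rule sorted_wrt_mono_rel[OF _ sorted_wrt_upt]) (auto simp: run_order_def)
qed (auto simp: run_order_def)

text \<open>A single ascent forces the shape: it straddles \<open>a\<close> and \<open>b\<close>,
  and comparing any other entry with its ends yields either a non-straddling ascent or a cyclically
  increasing triple, unless low entries precede high ones.\<close>

lemma straddling_run_order:
  assumes d: "distinct r" and "a \<notin> set r" "b \<notin> set r"
    and s: "straddles a b r" and t: "triplewise (\<lambda>x y z. \<not> cyc_increasing x y z) r"
    and nd: "\<not> sorted_wrt (>) r"
  shows "\<exists>x\<in>set r. x < a \<and> x < b" "\<exists>x\<in>set r. a < x \<and> b < x"
    and "\<forall>x\<in>set r. x < a \<longleftrightarrow> x < b"
    and "sorted_wrt (\<lambda>x y. x < a \<and> a < y \<or> y < x \<and> (x < a \<longleftrightarrow> y < a)) r"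
proof -
  have str: "r ! i < a \<and> a < r ! j \<and> r ! i < b \<and> b < r ! j"
    if "i < j" "j < length r" "r ! i < r ! j" for i j
    using s that unfolding straddles_def sorted_wrt_iff_nth_less by blast
  have cyc: "\<not> cyc_increasing (r ! i) (r ! j) (r ! k)" if "i < j" "j < k" "k < length r" for i j k
    using t that unfolding triplewise_iff_nth by blast
  have neq: "r ! i \<noteq> r ! j" if "i < length r" "j < length r" "i \<noteq> j" for i j
    using d that by (simp add: nth_eq_iff_index_eq)
  obtain i j where ij: "i < j" "j < length r" "\<not> r ! j < r ! i"
    using nd unfolding sorted_wrt_iff_nth_less by blast
  moreover have "r ! i \<noteq> r ! j" using ij neq[of i j] by simp
  ultimately have rij: "r ! i < r ! j" by simp
  note sij = str[OF ij(1,2) rij]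
  have il: "i < length r" using ij by simp
  show "\<exists>x\<in>set r. x < a \<and> x < b" using sij nth_mem[OF il] by blast
  show "\<exists>x\<in>set r. a < x \<and> b < x" using sij nth_mem[OF ij(2)] by blast
  \<comment> \<open>An entry between \<open>a\<close> and \<open>b\<close> lies in value between the
    ends of the ascent at \<open>i\<close>, \<open>j\<close>. By position it is right of
    \<open>i\<close> or left of \<open>j\<close>, and so forms an ascent that fails to straddle
    both.\<close>
  have same: "r ! m < a \<longleftrightarrow> r ! m < b" if m: "m < length r" for m
  proof (rule ccontr)
    assume "\<not> ?thesis"
    moreover have "r ! m \<noteq> a" "r ! m \<noteq> b" using nth_mem[OF m] assms(2,3) by auto
    ultimately have *: "r ! m < a \<and> b < r ! m \<or> r ! m < b \<and> a < r ! m" by linarith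
    then have lt: "r ! i < r ! m" "r ! m < r ! j" using sij by linarith+
    have "\<not> i < m" using str[of i m] m lt * by auto
    moreover have "\<not> m < j" using str[of m j] ij lt * by auto
    ultimately show False using ij by simp
  qed
  then show "\<forall>x\<in>set r. x < a \<longleftrightarrow> x < b" by (simp add: all_set_conv_all_nth)
  \<comment> \<open>A low entry after the ascent would either end an ascent that stays below
    \<open>a\<close>, or lie below both ends and complete a 231.\<close>
  have low_before: "l < j'"
    if *: "i' < j'" "j' < length r" "r ! i' < r ! j'" "l < length r" "r ! l < a" for i' j' l
  proof (rule ccontr)
    assume "\<not> l < j'"
    moreover have "l \<noteq> j'" using str[OF *(1-3)] *(5) by auto
    ultimately have l: "j' < l" by simp
    have "\<not> r ! i' < r ! l" using str[of i' l] l * by auto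
    moreover have "r ! i' \<noteq> r ! l" using neq[of i' l] l * by simp
    ultimately have "r ! l < r ! i'" by simp
    then show False using cyc[OF *(1) l *(4)] *(3) by (simp add: cyc_increasing_def)
  qed
  \<comment> \<open>The mirror argument: a high entry before the ascent would start an ascent above
    \<open>a\<close> or complete a 312.\<close>
  have high_after: "i' < h"
    if *: "i' < j'" "j' < length r" "r ! i' < r ! j'" "h < length r" "a < r ! h" for i' j' h
  proof (rule ccontr)
    assume "\<not> i' < h"
    moreover have "h \<noteq> i'" using str[OF *(1-3)] *(5) by auto
    ultimately have h: "h < i'" by simp
    have "\<not> r ! h < r ! j'" using str[of h j'] h * by auto
    moreover have "r ! h \<noteq> r ! j'" using neq[of h j'] h * by simp
    ultimately have "r ! j' < r ! h" by simp
    then show False using cyc[OF h *(1,2)] *(3) by (simp add: cyc_increasing_def)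
  qed
  have low_high: "l < h" if "l < length r" "h < length r" "r ! l < a" "a < r ! h" for l h
  proof -
    have "l < j" using low_before[OF ij(1,2) rij that(1,3)] .
    \<comment> \<open>The positions \<open>l\<close> and \<open>j\<close> now form an ascent
      themselves, to which \<open>high_after\<close> applies.\<close>
    moreover have "r ! l < r ! j" using that sij by linarith
    ultimately show ?thesis using high_after[OF _ ij(2) _ that(2,4)] by blast
  qed
  show "sorted_wrt (\<lambda>x y. x < a \<and> a < y \<or> y < x \<and> (x < a \<longleftrightarrow> y < a)) r"
    unfolding sorted_wrt_iff_nth_less
  proof (intro allI impI)
    fix u v assume uv: "u < v" "v < length r"
    then have ul: "u < length r" by simp
    have na: "r ! u \<noteq> a" "r ! v \<noteq> a" using nth_mem[OF ul] nth_mem[OF uv(2)] assms(2) by auto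
    show "r ! u < a \<and> a < r ! v \<or> r ! v < r ! u \<and> (r ! u < a \<longleftrightarrow> r ! v < a)"
    proof (cases "r ! u < r ! v")
      case True
      then show ?thesis using str[OF uv] by simp
    next
      case False
      then have "r ! v < r ! u" using neq[OF ul uv(2)] uv(1) by simp
      moreover have "\<not> (r ! v < a \<and> a < r ! u)" using low_high[OF uv(2) ul] uv(1) by auto
      ultimately show ?thesis using na by auto
    qed
  qed
qed

section \<open>Classification of the permutations into two families\<close>

definition decreasing_family :: "nat \<Rightarrow> nat \<times> nat \<Rightarrow> nat list" where
  "decreasing_family n = (\<lambda>(b, a). a # b # rev (sorted_list_of_set ({1..n} - {a, b})))"

text \<open>The bit \<open>s\<close> decides which of \<open>k + 1\<close> and \<open>k + 2\<close>
  comes first.\<close>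

definition two_run_family :: "nat \<Rightarrow> nat \<times> nat \<Rightarrow> nat list" where
  "two_run_family n = (\<lambda>(k, s). (k + 1 + s) # (k + 2 - s) # two_runs n k)"

text \<open>Pairs are \<open>(b, a)\<close>, with the second entry of the permutation first, so that
  \<open>a < b\<close> becomes a dependent sum over \<open>b\<close>; the image adds
  \<open>a = b + 1\<close>.\<close>

definition decreasing_index :: "nat \<Rightarrow> (nat \<times> nat) set" where
  "decreasing_index n = (SIGMA b:{1..n}. {1..<b}) \<union> (\<lambda>b. (b, b + 1)) ` {1..<n}"

lemma sorted_wrt_greater_unique:
  assumes "sorted_wrt (>) (r :: nat list)" "finite A" "set r = A"
  shows "r = rev (sorted_list_of_set A)"
proof (rule sorted_wrt_unique[OF assms(1)])
  show "sorted_wrt (>) (rev (sorted_list_of_set A))" by (simp add: sorted_wrt_rev)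
qed (use assms in auto)

text \<open>For \<open>n = 3\<close> the second family is empty, because \<open>{1..n - 3}\<close>
  is.\<close>

lemma S3_eq:
  assumes "n \<ge> 3"
  shows "S3 n [3,1,2] [1,2,3] [2,3,1] =
    decreasing_family n ` decreasing_index n \<union> two_run_family n ` ({1..n - 3} \<times> {0, 1})"
    (is "?S = ?D \<union> ?T")
proof (intro subset_antisym subsetI)
  fix p assume p: "p \<in> ?S"
  then have dp: "distinct p" "set p = {1..n}"
    by (auto simp: S3_def permutations_of_set_def)
  then have "length p = n" by (metis card_atLeastAtMost diff_Suc_1 distinct_card)
  with assms obtain a b r where pr: "p = a # b # r"
    by (metis Suc_le_length_iff numeral_3_eq_3)
  have ab: "a \<notin> set r" "b \<notin> set r" "a \<noteq> b" "distinct r" "a \<in> {1..n}" "b \<in> {1..n}"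
    and setr: "set r = {1..n} - {a, b}"
    using dp pr by auto
  have c: "straddles a b r" "triplewise (\<lambda>x y z. \<not> cyc_increasing x y z) r"
    "\<forall>x\<in>set r. \<not> (b < x \<and> x < a)"
    using p avoids_rotations_iff[of a b r] dp(1) pr unfolding S3_def by auto
  have adj: "a < b \<or> a = b + 1"
  proof (rule ccontr)
    assume "\<not> ?thesis"
    then have "b + 1 \<in> set r" "b + 1 < a" using setr ab by auto
    then show False using c(3) by auto
  qed
  show "p \<in> ?D \<union> ?T"
  proof (cases "sorted_wrt (>) r")
    case True
    then have "r = rev (sorted_list_of_set ({1..n} - {a, b}))"
      using setr by (intro sorted_wrt_greater_unique) auto
    then have "p = decreasing_family n (b, a)" by (simp add: pr decreasing_family_def)
    moreover have "(b, a) \<in> decreasing_index n"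
      using adj ab by (auto simp: decreasing_index_def)
    ultimately show ?thesis by blast
  next
    case False
    note R = straddling_run_order[OF ab(4,1,2) c(1,2) False]
    \<comment> \<open>The low run will be \<open>k ... 1\<close>, ending just below the smaller of
      \<open>a\<close> and \<open>b\<close>.\<close>
    define k where "k = min a b - 1"
    obtain x y where xy: "x \<in> set r" "x < a" "x < b" "y \<in> set r" "a < y" "b < y"
      using R(1,2) by blast
    have near: "b = a + 1 \<or> a = b + 1"
    proof (rule ccontr)
      assume *: "\<not> ?thesis"
      with adj have "a + 1 < b" by auto
      then have "a + 1 \<in> set r" using setr ab by auto
      with R(3) \<open>a + 1 < b\<close> show False by auto
    qed
    \<comment> \<open>The low entry \<open>x\<close> gives \<open>1 \<le> k\<close>, and the high
      entry \<open>y\<close> gives \<open>k + 3 \<le> n\<close>.\<close>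
    have "1 \<le> x" "y \<le> n" using xy(1,4) setr by auto
    with near xy have k: "1 \<le> k" "k \<le> n - 3" "k + 3 \<le> n"
      and abk: "a = k + 1 \<and> b = k + 2 \<or> a = k + 2 \<and> b = k + 1"
      unfolding k_def min_def by (simp_all split: if_splits) linarith+
    \<comment> \<open>Since \<open>a\<close> and \<open>b\<close> are \<open>k + 1\<close> and
      \<open>k + 2\<close> in some order, an entry of \<open>r\<close> is below \<open>a\<close>
      exactly when it is at most \<open>k\<close>.\<close>
    have "sorted_wrt (run_order k) r"
    proof (rule sorted_wrt_mono_rel[OF _ R(4)])
      fix u v assume uv: "u \<in> set r" "v \<in> set r" "u < a \<and> a < v \<or> v < u \<and> (u < a \<longleftrightarrow> v < a)"
      then have "u \<noteq> a" "u \<noteq> b" "v \<noteq> a" "v \<noteq> b" using ab by auto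
      with uv(3) abk show "run_order k u v" unfolding run_order_def by auto
    qed
    then have "r = two_runs n k"
    proof (rule sorted_wrt_unique[OF _ sorted_wrt_two_runs])
      show "set r = set (two_runs n k)"
        unfolding setr two_runs_def using abk k by auto
    qed (auto simp: run_order_def split: if_splits)
    then have "p = two_run_family n (k, a - (k + 1))"
      using abk by (auto simp: two_run_family_def pr)
    moreover have "(k, a - (k + 1)) \<in> {1..n - 3} \<times> {0, 1}" using k abk by auto
    ultimately show ?thesis by blast
  qed
next
  fix p assume "p \<in> ?D \<union> ?T"
  then show "p \<in> ?S"
  proof
    assume "p \<in> ?D"
    then obtain a b where ab: "(b, a) \<in> decreasing_index n" "p = decreasing_family n (b, a)"
      by auto
    define r where "r = rev (sorted_list_of_set ({1..n} - {a, b}))"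
    have p: "p = a # b # r" by (simp add: ab r_def decreasing_family_def)
    have ab': "a \<in> {1..n}" "b \<in> {1..n}" "a \<noteq> b" "a < b \<or> a = b + 1"
      using ab(1) by (auto simp: decreasing_index_def)
    have dp: "distinct p" "set p = {1..n}" using ab' by (auto simp: p r_def)
    have sr: "sorted_wrt (>) r" by (simp add: r_def sorted_wrt_rev)
    have "straddles a b r"
      unfolding straddles_def by (rule sorted_wrt_mono_rel[OF _ sr]) auto
    moreover have "triplewise (\<lambda>x y z. \<not> cyc_increasing x y z) r"
      unfolding triplewise_iff_nth
    proof (intro allI impI)
      fix i j k assume "i < j" "j < k" "k < length r"
      then have "r ! j < r ! i" "r ! k < r ! j"
        using sr unfolding sorted_wrt_iff_nth_less by auto
      then show "\<not> cyc_increasing (r ! i) (r ! j) (r ! k)" unfolding cyc_increasing_def by auto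
    qed
    moreover have "\<forall>x\<in>set r. \<not> (b < x \<and> x < a)" using ab' by auto
    ultimately show ?thesis
      using avoids_rotations_iff[of a b r] dp
      by (auto simp: S3_def p permutations_of_set_def)
  next
    assume "p \<in> ?T"
    then obtain k s where ks: "k \<in> {1..n - 3}" "s \<in> {0, 1}" "p = two_run_family n (k, s)"
      by blast
    define a b r where abr: "a = k + 1 + s" "b = k + 2 - s" "r = two_runs n k"
    have p: "p = a # b # r" by (simp add: ks abr two_run_family_def)
    have abk: "a = k + 1 \<and> b = k + 2 \<or> a = k + 2 \<and> b = k + 1" using ks abr by auto
    have set_r: "set r = {1..<k + 1} \<union> {k + 3..<n + 1}"
      by (simp only: abr(3) two_runs_def set_append set_rev set_upt)
    have kn: "k + 3 \<le> n" using ks(1) assms by auto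
    have setr: "set r = {1..n} - {a, b}" "a \<in> {1..n}" "b \<in> {1..n}"
      using abk kn by (auto simp: set_r)
    have "distinct r" by (auto simp: abr(3) two_runs_def)
    moreover have "a \<notin> set r" "b \<notin> set r" using setr(1) by blast+
    moreover have "a \<noteq> b" using abk by linarith
    ultimately have dp: "distinct p" by (simp add: p)
    have "set p = {a, b} \<union> set r" by (simp add: p)
    also have "\<dots> = {1..n}" unfolding setr(1) using setr(2,3) by (simp only: Un_Diff_cancel) auto
    finally have sp: "set p = {1..n}" .
    have sr: "sorted_wrt (run_order k) r" by (simp add: abr sorted_wrt_two_runs)
    have "straddles a b r"
      unfolding straddles_def
    proof (rule sorted_wrt_mono_rel[OF _ sr])
      fix u v assume uv: "u \<in> set r" "v \<in> set r" "run_order k u v"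
      then have "u \<noteq> a" "u \<noteq> b" "v \<noteq> a" "v \<noteq> b" using setr by auto
      with uv(3) abk show "u < v \<longrightarrow> u < a \<and> a < v \<and> u < b \<and> b < v"
        unfolding run_order_def by (auto split: if_splits)
    qed
    moreover have "triplewise (\<lambda>x y z. \<not> cyc_increasing x y z) r"
      unfolding triplewise_iff_nth
    proof (intro allI impI)
      \<comment> \<open>A cyclic increase contains an ascent between neighbours in the triple, which
        must cross from at most \<open>k\<close> to above \<open>k\<close>; the order allows no
        second crossing and no return.\<close>
      fix i j l assume "i < j" "j < l" "l < length r"
      then have "run_order k (r ! i) (r ! j)" "run_order k (r ! j) (r ! l)"
        using sr unfolding sorted_wrt_iff_nth_less by auto
      then show "\<not> cyc_increasing (r ! i) (r ! j) (r ! l)"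
        unfolding cyc_increasing_def run_order_def by (auto split: if_splits)
    qed
    moreover have "\<forall>x\<in>set r. \<not> (b < x \<and> x < a)" using abk by auto
    ultimately show ?thesis
      using avoids_rotations_iff[of a b r] dp sp
      by (auto simp: S3_def p permutations_of_set_def)
  qed
qed

section \<open>Counting the two families\<close>

lemma card_decreasing_index: "2 * card (decreasing_index n) = n * (n - 1) + 2 * (n - 1)"
proof -
  have "card (decreasing_index n) =
      card (SIGMA b:{1..n}. {1..<b}) + card ((\<lambda>b. (b, b + 1)) ` {1..<n})"
    unfolding decreasing_index_def by (rule card_Un_disjoint) auto
  also have "card ((\<lambda>b. (b, b + 1)) ` {1..<n}) = n - 1"
    by (subst card_image) (auto simp: inj_on_def)
  also have "card (SIGMA b:{1..n}. {1..<b}) = (\<Sum>b\<in>{1..n}. b - 1)"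
    by simp
  moreover have "2 * (\<Sum>b\<in>{1..n}. b - 1) = n * (n - 1)"
  proof (induction n)
    case (Suc n)
    then show ?case by (cases n) (simp_all add: algebra_simps)
  qed simp
  ultimately show ?thesis by simp
qed

lemma card_S3:
  assumes "n \<ge> 3"
  shows "2 * card (S3 n [3,1,2] [1,2,3] [2,3,1]) = n * (n - 1) + 2 * (n - 1) + 4 * (n - 3)"
proof -
  let ?D = "decreasing_family n ` decreasing_index n"
  let ?T = "two_run_family n ` ({1..n - 3} \<times> {0, 1})"
  have "?D \<inter> ?T = {}"
  proof (rule ccontr)
    assume "?D \<inter> ?T \<noteq> {}"
    then obtain q k s where q: "decreasing_family n q = two_run_family n (k, s)" "k \<in> {1..n - 3}"
      by (auto simp del: atLeastAtMost_iff)
    \<comment> \<open>A common member would make this tail decreasing, although 1 stands before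
      \<open>n\<close> in it.\<close>
    have "sorted_wrt (>) (two_runs n k)"
      using q(1) by (cases q) (auto simp: decreasing_family_def two_run_family_def sorted_wrt_rev
          dest: sym)
    moreover have "1 \<in> set (rev [1..<k + 1])" "n \<in> set (rev [k + 3..<n + 1])" using q(2) assms by auto
    ultimately have "n < 1" unfolding two_runs_def sorted_wrt_append by blast
    then show False using assms by simp
  qed
  moreover have "finite (decreasing_index n)" by (auto simp: decreasing_index_def)
  ultimately have "card (?D \<union> ?T) = card ?D + card ?T" by (intro card_Un_disjoint) auto
  moreover have "card ?D = card (decreasing_index n)"
    by (rule card_image) (auto simp: inj_on_def decreasing_family_def)
  \<comment> \<open>The first two entries sum to \<open>2 * k + 3\<close>, which determines
    \<open>k\<close> and then \<open>s\<close>.\<close>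
  moreover have "inj_on (two_run_family n) ({1..n - 3} \<times> {0, 1})"
    by (auto simp: inj_on_def two_run_family_def)
  then have "card ?T = 2 * (n - 3)" by (simp add: card_image card_cartesian_product)
  ultimately show ?thesis using card_decreasing_index[of n] S3_eq[OF assms] by simp
qed

section \<open>Complementing the values\<close>

lemma contains_pattern_complement:
  assumes "contains_pattern p q" "distinct p" "distinct q" "set p \<subseteq> {..n}" "set q \<subseteq> {..m}"
  shows "contains_pattern (map (\<lambda>x. n - x) p) (map (\<lambda>x. m - x) q)"
proof -
  obtain i where i: "strict_mono_on {..<length q} i" "i ` {..<length q} \<subseteq> {..<length p}"
    "\<And>a b. a < b \<Longrightarrow> b < length q \<Longrightarrow> (p ! i a < p ! i b \<longleftrightarrow> q ! a < q ! b)"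
    using assms(1) unfolding contains_pattern_def by blast
  have "(map (\<lambda>x. n - x) p ! i a < map (\<lambda>x. n - x) p ! i b \<longleftrightarrow>
      map (\<lambda>x. m - x) q ! a < map (\<lambda>x. m - x) q ! b)" if ab: "a < b" "b < length q" for a b
  proof -
    have l: "i a < length p" "i b < length p" "a < length q"
      using i(2) ab by (auto simp: image_subset_iff)
    have "i a < i b" using i(1) ab by (auto simp: strict_mono_on_def)
    \<comment> \<open>Distinctness turns "not less" into "greater", and the upper bounds keep the
      truncated subtraction faithful, so every comparison is reversed.\<close>
    then have "p ! i a \<noteq> p ! i b" "q ! a \<noteq> q ! b"
      using assms(2,3) l ab by (simp_all add: nth_eq_iff_index_eq)
    moreover have "p ! i a \<le> n" "p ! i b \<le> n" "q ! a \<le> m" "q ! b \<le> m"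
      using assms(4,5) l ab nth_mem by (metis atMost_iff subsetD)+
    ultimately show ?thesis using i(3)[OF ab] l ab by auto
  qed
  with i(1,2) show ?thesis unfolding contains_pattern_def by (intro exI[of _ i]) simp
qed

lemma rotation_map: "rotation (map f p) i = map f (rotation p i)"
  by (simp add: rotation_def rotate_map)

lemma S3_complement:
  assumes p: "p \<in> S3 n (map (\<lambda>x. m - x) q1) (map (\<lambda>x. m - x) q2) (map (\<lambda>x. m - x) q3)"
    and q: "\<And>q. q \<in> {q1, q2, q3} \<Longrightarrow> distinct q \<and> set q \<subseteq> {..m}"
  shows "map (\<lambda>x. n + 1 - x) p \<in> S3 n q1 q2 q3"
proof -
  let ?c = "\<lambda>x. n + 1 - x"
  have dp: "distinct p" "set p = {1..n}"
    using p by (auto simp: S3_def permutations_of_set_def)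
  have "?c ` {1..n} = {1..n}"
  proof (intro subset_antisym subsetI)
    fix x assume "x \<in> {1..n}"
    then have "x = ?c (?c x)" "?c x \<in> {1..n}" by auto
    then show "x \<in> ?c ` {1..n}" by blast
  qed auto
  then have perm: "map ?c p \<in> permutations_of_set {1..n}"
    using dp by (auto simp: permutations_of_set_def distinct_map inj_on_def)
  have "contains_pattern (rotation p i) (map (\<lambda>x. m - x) q)"
    if "contains_pattern (rotation (map ?c p) i) q" "q \<in> {q1, q2, q3}" for i q
  proof -
    \<comment> \<open>Complementing a second time carries an occurrence back to \<open>p\<close>,
      since \<open>map ?c\<close> is an involution there and commutes with rotation.\<close>
    have "contains_pattern (map ?c (rotation (map ?c p) i)) (map (\<lambda>x. m - x) q)"
      using perm q[OF that(2)] that(1)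
      by (intro contains_pattern_complement) (auto simp: rotation_def permutations_of_set_def)
    moreover have "map ?c (map ?c p) = p" using dp by (auto intro!: map_idI)
    ultimately show ?thesis by (simp only: rotation_map[symmetric])
  qed
  then show ?thesis using p perm unfolding S3_def by blast
qed

lemma card_S3_complement:
  "card (S3 n [3,1,2] [1,2,3] [2,3,1]) = card (S3 n [1,3,2] [3,2,1] [2,1,3])"
proof (rule bij_betw_same_card)
  let ?f = "map (\<lambda>x. n + 1 - x)"
  show "bij_betw ?f (S3 n [3,1,2] [1,2,3] [2,3,1]) (S3 n [1,3,2] [3,2,1] [2,1,3])"
  proof (rule bij_betw_byWitness[where f' = ?f])
    show "?f ` S3 n [3,1,2] [1,2,3] [2,3,1] \<subseteq> S3 n [1,3,2] [3,2,1] [2,1,3]"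
      \<comment> \<open>Subtracting from 4 complements patterns of length three: 132, 321, 213
        become 312, 123, 231.\<close>
      by (intro image_subsetI S3_complement[of _ n 4 "[1,3,2]" "[3,2,1]" "[2,1,3]"]) auto
    show "?f ` S3 n [1,3,2] [3,2,1] [2,1,3] \<subseteq> S3 n [3,1,2] [1,2,3] [2,3,1]"
      by (intro image_subsetI S3_complement[of _ n 4 "[3,1,2]" "[1,2,3]" "[2,3,1]"]) auto
  qed (auto simp: S3_def permutations_of_set_def intro!: map_idI)
qed

theorem theorem4p4:
  fixes n :: nat
  assumes "n \<ge> 3"
  shows "card (S3 n [3,1,2] [1,2,3] [2,3,1]) = card (S3 n [1,3,2] [3,2,1] [2,1,3]) \<and>
         real (card (S3 n [1,3,2] [3,2,1] [2,1,3])) = 1 / 2 * (real n + 7) * (real n - 2)"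
proof -
  \<comment> \<open>This removes truncated subtraction; \<open>m + 1\<close> stands for
    \<open>n - 2\<close>.\<close>
  obtain m where m: "n = m + 3" using assms by (metis add.commute le_Suc_ex)
  have "2 * card (S3 n [1,3,2] [3,2,1] [2,1,3]) = (n + 7) * (m + 1)"
    using card_S3[OF assms] unfolding card_S3_complement by (simp add: m algebra_simps)
  then have "real (2 * card (S3 n [1,3,2] [3,2,1] [2,1,3])) = real ((n + 7) * (m + 1))"
    by (rule arg_cong)
  then have "real (card (S3 n [1,3,2] [3,2,1] [2,1,3])) = 1 / 2 * (real n + 7) * (real n - 2)"
    by (simp add: m field_simps)
  then show ?thesis using card_S3_complement by simp
qed

end
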